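(* Let $G$ be a critical graph with $n$ vertices such that $\operatorname{td}(G) \geq n-1$. Then $G$ is 1-unique.
   Context: Graphs are finite and simple (loops and parallel edges produced by edge contraction are discarded). A labeling of a graph $G$ assigns a positive integer to each vertex. A labeling is feasible if every path between two distinct vertices with the same label contains a vertex having a higher label. The tree-depth $\operatorname{td}(G)$ is the smallest $k$ for which $G$ has a feasible labeling with labels from $\{1,\dots,k\}$. A graph $G$ is critical (or $k$-critical, with $k=\operatorname{td}(G)$) if every proper minor of $G$ has tree-depth strictly less than $\operatorname{td}(G)$. A graph $G$ is 1-unique if for every vertex $v$ of $G$ there is a feasible labeling of $G$ with labels from $\{1,\dots,\operatorname{td}(G)\}$ in which $v$ is the unique vertex receiving the label 1. *)

theory Defs
  imports "Graph_Theory.Graph_Theory"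
begin

text \<open>
  Finite simple graphs are the \<^locale>\<open>pair_graph\<close>s of the library: a finite vertex set with a
  symmetric irreflexive set of arcs, an edge being a pair of opposite arcs. The graph without
  vertices is allowed.
\<close>

definition feasible_labeling :: "'a pair_pre_digraph \<Rightarrow> ('a \<Rightarrow> nat) \<Rightarrow> bool" where
  "feasible_labeling G f \<longleftrightarrow>
     (\<forall>v\<in>pverts G. 1 \<le> f v) \<and>
     (\<forall>p. vpath p (with_proj G) \<and> hd p \<noteq> last p \<and> f (hd p) = f (last p) \<longrightarrow>
          (\<exists>w\<in>set p. f (hd p) < f w))"

definition tree_depth :: "'a pair_pre_digraph \<Rightarrow> nat" where
  "tree_depth G = (LEAST k. \<exists>f. feasible_labeling G f \<and> f ` pverts G \<subseteq> {1..k})"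

definition delete_vertex :: "'a pair_pre_digraph \<Rightarrow> 'a \<Rightarrow> 'a pair_pre_digraph" where
  "delete_vertex G v =
     \<lparr> pverts = pverts G - {v}, parcs = {(x, y) \<in> parcs G. x \<noteq> v \<and> y \<noteq> v} \<rparr>"

definition delete_edge :: "'a pair_pre_digraph \<Rightarrow> 'a \<Rightarrow> 'a \<Rightarrow> 'a pair_pre_digraph" where
  "delete_edge G u v = \<lparr> pverts = pverts G, parcs = parcs G - {(u, v), (v, u)} \<rparr>"

text \<open>
  The vertex arising from contracting the edge \<open>uv\<close> keeps the name \<open>u\<close>. Parallel edges disappear
  because the arcs form a set; the loop is removed explicitly.
\<close>

definition contract_edge :: "'a pair_pre_digraph \<Rightarrow> 'a \<Rightarrow> 'a \<Rightarrow> 'a pair_pre_digraph" where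
  "contract_edge G u v =
     (let r = (\<lambda>x. if x = v then u else x) in
      \<lparr> pverts = r ` pverts G,
        parcs = {(r x, r y) | x y. (x, y) \<in> parcs G \<and> r x \<noteq> r y} \<rparr>)"

inductive minor_step :: "'a pair_pre_digraph \<Rightarrow> 'a pair_pre_digraph \<Rightarrow> bool" where
  delete_vertex: "v \<in> pverts G \<Longrightarrow> minor_step G (delete_vertex G v)"
| delete_edge: "(u, v) \<in> parcs G \<Longrightarrow> minor_step G (delete_edge G u v)"
| contract_edge: "(u, v) \<in> parcs G \<Longrightarrow> minor_step G (contract_edge G u v)"

text \<open>
  Minors are taken on subsets of the original vertex set, so there is one representative (at least)
  of every isomorphism class of proper minors. Each step decreases the number of vertices plus the
  number of edges, so a minor obtained by at least one step is never isomorphic to the original.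
\<close>

definition proper_minor :: "'a pair_pre_digraph \<Rightarrow> 'a pair_pre_digraph \<Rightarrow> bool" where
  "proper_minor H G \<longleftrightarrow> minor_step\<^sup>+\<^sup>+ G H"

definition critical :: "'a pair_pre_digraph \<Rightarrow> bool" where
  "critical G \<longleftrightarrow> (\<forall>H. proper_minor H G \<longrightarrow> tree_depth H < tree_depth G)"

definition one_unique :: "'a pair_pre_digraph \<Rightarrow> bool" where
  "one_unique G \<longleftrightarrow>
     (\<forall>v\<in>pverts G. \<exists>f. feasible_labeling G f \<and> f ` pverts G \<subseteq> {1..tree_depth G} \<and>
        {w \<in> pverts G. f w = 1} = {v})"

lemma minor_step_pair_graph:
  assumes "minor_step G H" and "pair_graph G"
  shows "pair_graph H"
proof -
  interpret pair_graph G by fact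
  have fin: "finite {(r x, r y) | x y. (x, y) \<in> parcs G \<and> r x \<noteq> r y}" for r :: "'a \<Rightarrow> 'a"
    by (rule finite_subset[OF _ finite_imageI[OF pair_finite_arcs, of "map_prod r r"]]) force
  from assms(1) show ?thesis
  proof cases
    case (delete_vertex v)
    have "finite (parcs H)"
      by (rule finite_subset[OF _ pair_finite_arcs]) (auto simp: delete_vertex delete_vertex_def)
    then show ?thesis
      using arcs_symmetric wellformed' no_loops' pair_finite_verts
      by unfold_locales (auto simp: delete_vertex delete_vertex_def symmetric_def sym_def)
  next
    case (delete_edge u v)
    then show ?thesis
      using arcs_symmetric wellformed' no_loops' pair_finite_verts pair_finite_arcs
      by unfold_locales (auto simp: delete_edge_def symmetric_def sym_def)
  next
    case (contract_edge u v)
    define r where "r = (\<lambda>x. if x = v then u else x)"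
    have H: "pverts H = r ` pverts G"
      "parcs H = {(r x, r y) | x y. (x, y) \<in> parcs G \<and> r x \<noteq> r y}"
      by (simp_all add: contract_edge contract_edge_def Let_def r_def)
    show ?thesis
    proof unfold_locales
      show "finite (parcs H)" unfolding H by (rule fin)
      show "finite (pverts H)" unfolding H using pair_finite_verts by simp
      show "symmetric (with_proj H)"
        unfolding symmetric_def with_proj_simps
      proof (rule symI)
        fix a b assume "(a, b) \<in> parcs H"
        then obtain x y where "a = r x" "b = r y" "(x, y) \<in> parcs G" "r x \<noteq> r y"
          unfolding H by blast
        moreover from this have "(y, x) \<in> parcs G" by (blast intro: arcs_symmetric)
        ultimately show "(b, a) \<in> parcs H" unfolding H by force
      qed
    qed (auto simp: H dest: wellformed')
  qed
qed

lemma tree_depth_attained: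
  assumes "finite (pverts G)"
  shows "\<exists>f. feasible_labeling G f \<and> f ` pverts G \<subseteq> {1..tree_depth G}"
proof -
  obtain g where g: "bij_betw g (pverts G) {0..<card (pverts G)}"
    using ex_bij_betw_finite_nat[OF assms] by blast
  have "feasible_labeling G (Suc \<circ> g)"
    unfolding feasible_labeling_def
  proof (intro conjI allI impI)
    fix p assume p: "vpath p (with_proj G) \<and> hd p \<noteq> last p \<and> (Suc \<circ> g) (hd p) = (Suc \<circ> g) (last p)"
    then have "hd p \<in> pverts G" "last p \<in> pverts G"
      by (auto simp: vpath_def vwalk_def)
    with p g show "\<exists>w\<in>set p. (Suc \<circ> g) (hd p) < (Suc \<circ> g) w"
      by (auto dest: bij_betw_imp_inj_on inj_onD)
  qed simp
  moreover have "(Suc \<circ> g) ` pverts G \<subseteq> {1..card (pverts G)}"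
    using bij_betwE[OF g] by (auto simp: Suc_le_eq)
  ultimately show ?thesis
    unfolding tree_depth_def by (intro LeastI_ex[of "\<lambda>k. \<exists>f. feasible_labeling G f \<and> f ` pverts G \<subseteq> {1..k}"]) blast
qed

end

theory Submission
  imports Defs
begin

text \<open>
  Let \<open>H\<close> be the complement of \<open>G\<close>. A labeling with two labels fewer than vertices repeats a label
  on three vertices or repeats two labels, and it is feasible only if \<open>H\<close> contains a triangle or a
  4-cycle; conversely these give such labelings. Hence \<open>td(G) \<ge> n - 1\<close> iff \<open>H\<close> has no cycle of
  length 3 or 4.

  If \<open>td(G) = n\<close>, use an injective labeling. Otherwise let \<open>v\<close> be a vertex. If \<open>H - v\<close> has an edge \<open>xy\<close> such that \<open>v\<close> is not joined in \<open>G\<close> to both \<open>x\<close> and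
  \<open>y\<close>, label \<open>v\<close> with 1, \<open>x\<close> and \<open>y\<close> with 2, and all other vertices injectively. If \<open>H - v\<close> has no
  edge, \<open>G - v\<close> is complete and has tree-depth \<open>n - 1\<close>, against criticality. Otherwise the component
  of \<open>v\<close> in \<open>H\<close> is a star that avoids some edge \<open>xy\<close> of \<open>H\<close>; adding \<open>vx\<close> to \<open>H\<close> creates no cycle, so
  deleting \<open>vx\<close> from \<open>G\<close> does not decrease the tree-depth below \<open>n - 1\<close>, against criticality.
\<close>

text \<open>This is the edge relation of the complement of \<open>G\<close>.\<close>

definition nonadjacent :: "'a pair_pre_digraph \<Rightarrow> 'a \<Rightarrow> 'a \<Rightarrow> bool" where
  "nonadjacent G x y \<longleftrightarrow> x \<in> pverts G \<and> y \<in> pverts G \<and> x \<noteq> y \<and> (x, y) \<notin> parcs G"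

lemma (in pair_graph) nonadjacent_sym: "nonadjacent G x y \<Longrightarrow> nonadjacent G y x"
  by (auto simp: nonadjacent_def dest: arcs_symmetric)

lemma tree_depth_le:
  assumes "feasible_labeling G f" "f ` pverts G \<subseteq> {1..k}"
  shows "tree_depth G \<le> k"
  unfolding tree_depth_def by (rule Least_le) (use assms in blast)

lemma feasible_labeling_adjacent:
  assumes "feasible_labeling G f" "x \<in> pverts G" "y \<in> pverts G" "x \<noteq> y" "f x = f y"
  shows "nonadjacent G x y"
proof (rule ccontr)
  assume "\<not> nonadjacent G x y"
  then have "vpath [x, y] (with_proj G)"
    using assms by (auto simp: nonadjacent_def vpath_def vwalk_def)
  then have "\<exists>w\<in>set [x, y]. f (hd [x, y]) < f w"
    using assms unfolding feasible_labeling_def by (metis last.simps list.sel(1) list.discI)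
  then show False using assms by simp
qed

text \<open>Otherwise \<open>x\<close>, \<open>z\<close>, \<open>y\<close> would be a path whose
  equal end labels are not exceeded on it.\<close>

lemma feasible_labeling_common_neighbour:
  assumes "feasible_labeling G f" "x \<noteq> y" "f x = f y" "f z < f x"
    and "x \<in> pverts G" "y \<in> pverts G" "z \<in> pverts G"
  shows "nonadjacent G x z \<or> nonadjacent G z y"
proof (rule ccontr)
  assume "\<not> (nonadjacent G x z \<or> nonadjacent G z y)"
  then have "vpath [x, z, y] (with_proj G)"
    using assms by (auto simp: nonadjacent_def vpath_def vwalk_def)
  then have "\<exists>w\<in>set [x, z, y]. f (hd [x, z, y]) < f w"
    using assms unfolding feasible_labeling_def by (metis last.simps list.sel(1) list.discI)
  then show False using assms by simp
qed

lemma card_le_tree_depth_complete: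
  assumes "finite (pverts G)" "\<And>x y. \<not> nonadjacent G x y"
  shows "card (pverts G) \<le> tree_depth G"
proof -
  obtain f where f: "feasible_labeling G f" "f ` pverts G \<subseteq> {1..tree_depth G}"
    using tree_depth_attained[OF assms(1)] by blast
  then have "inj_on f (pverts G)"
    using assms(2) feasible_labeling_adjacent by (metis inj_onI)
  then show ?thesis using card_inj_on_le[OF _ f(2)] by simp
qed

text \<open>Label \<open>A\<close> with 1, \<open>B\<close> with 2 and the rest injectively above. A
  bad path with ends in \<open>A\<close> would stay in the independent set \<open>A\<close>; one
  with ends in \<open>B\<close> would stay in \<open>A\<close> and \<open>B\<close>, hence start
  \<open>x\<close>, \<open>z\<close>, \<open>u\<close> with \<open>z\<close> in \<open>A\<close>
  between two vertices of \<open>B\<close>.\<close>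

lemma (in pair_graph) two_level_labeling:
  assumes sub: "A \<subseteq> pverts G" "B \<subseteq> pverts G" and disj: "A \<inter> B = {}"
    and A: "\<And>x y. x \<in> A \<Longrightarrow> y \<in> A \<Longrightarrow> (x, y) \<notin> parcs G"
    and B: "\<And>x y. x \<in> B \<Longrightarrow> y \<in> B \<Longrightarrow> (x, y) \<notin> parcs G"
    and AB: "\<And>x y z. x \<in> B \<Longrightarrow> y \<in> B \<Longrightarrow> x \<noteq> y \<Longrightarrow> z \<in> A \<Longrightarrow> \<not> ((x, z) \<in> parcs G \<and> (z, y) \<in> parcs G)"
  shows "\<exists>f. feasible_labeling G f
    \<and> f ` pverts G \<subseteq> {1..Suc (of_bool (B \<noteq> {}) + card (pverts G - A - B))}
    \<and> {w \<in> pverts G. f w = 1} = A"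
proof -
  let ?R = "pverts G - A - B"
  \<comment> \<open>The remaining vertices get labels above \<open>m\<close>, so label 2 is not
    wasted when \<open>B\<close> is empty.\<close>
  define m where "m = Suc (of_bool (B \<noteq> {}))"
  have m: "1 \<le> m" "B \<noteq> {} \<Longrightarrow> m = 2" by (auto simp: m_def)
  obtain g where g: "bij_betw g ?R {0..<card ?R}"
    using ex_bij_betw_finite_nat[of ?R] pair_finite_verts by auto
  define f where "f = (\<lambda>w. if w \<in> A then 1 else if w \<in> B then 2 else m + Suc (g w))"
  have f1: "f w = 1 \<longleftrightarrow> w \<in> A" for w using m by (auto simp: f_def)
  have f2: "w \<in> A \<union> B" if "f w \<le> 2" "B \<noteq> {}" for w
    using that m by (auto simp: f_def split: if_splits)
  have fR: "m < f w" if "w \<in> ?R" for w using that by (auto simp: f_def)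
  have pos: "1 \<le> f w" for w using m by (auto simp: f_def)
  have feas: "\<exists>w\<in>set p. f (hd p) < f w"
    if p: "vpath p (with_proj G)" "hd p \<noteq> last p" "f (hd p) = f (last p)" for p
  proof (rule ccontr)
    assume "\<not> ?thesis"
    then have le: "\<And>w. w \<in> set p \<Longrightarrow> f w \<le> f (hd p)" by force
    obtain x z q where pq: "p = x # z # q"
      using p by (cases p; cases "tl p") (auto simp: vpath_def vwalk_def)
    have in_V: "set p \<subseteq> pverts G" and dist: "distinct p" and xz: "(x, z) \<in> parcs G"
      using p(1) by (auto simp: pq vpath_def vwalk_def)
    let ?y = "last p"
    have y: "?y \<in> set p" by (simp add: pq)
    consider "x \<in> A" | "x \<in> B" | "x \<in> ?R" using in_V by (auto simp: pq)
    then show False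
    proof cases
      case 1
      then have "f z = 1" using le[of z] pos[of z] f1[of x] by (simp add: pq)
      then show False using A[of x z] 1 xz f1 by simp
    next
      case 2
      have fx: "f x = 2" using 2 disj by (auto simp: f_def)
      have "set p \<subseteq> A \<union> B" using le f2 fx 2 by (force simp: pq)
      then have zA: "z \<in> A" using B[of x z] 2 xz by (auto simp: pq)
      have yB: "?y \<in> B"
        using f2[of ?y] f1[of ?y] p(3) fx 2 by (cases "B = {}") (auto simp: pq)
      \<comment> \<open>The path cannot stop at \<open>z\<close>, since its other end lies in
        \<open>B\<close>.\<close>
      have "q \<noteq> []" using zA yB disj by (auto simp: pq)
      then obtain u r where q: "q = u # r" by (cases q) auto
      have zu: "(z, u) \<in> parcs G" using p(1) by (auto simp: pq q vpath_def vwalk_def)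
      have "u \<in> B" using \<open>set p \<subseteq> A \<union> B\<close> A[OF zA] zu by (auto simp: pq q)
      moreover have "x \<noteq> u" using dist by (auto simp: pq q)
      ultimately show False using AB[OF 2 _ _ zA] xz zu by blast
    next
      case 3
      have "f x = f ?y" using p by (simp add: pq)
      moreover have "?y \<in> ?R"
      proof -
        have "m < f ?y" using fR[OF 3] p by (simp add: pq)
        then show ?thesis using m in_V y disj by (auto simp: f_def split: if_splits)
      qed
      ultimately have "g x = g ?y" using 3 by (auto simp: f_def)
      then have "x = ?y"
        using g 3 \<open>?y \<in> ?R\<close> by (metis bij_betw_imp_inj_on inj_onD)
      then show False using p(2) by (simp add: pq)
    qed
  qed
  have range: "f w \<in> {1..m + card ?R}" if "w \<in> pverts G" for w
  proof (cases "w \<in> ?R")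
    case True
    then have "g w < card ?R" using bij_betwE[OF g] by auto
    then show ?thesis using True by (auto simp: f_def)
  next
    case False
    then show ?thesis using that m by (cases "B = {}") (auto simp: f_def)
  qed
  show ?thesis
  proof (intro exI conjI)
    show "feasible_labeling G f"
      unfolding feasible_labeling_def using pos feas by blast
    show "f ` pverts G \<subseteq> {1..Suc (of_bool (B \<noteq> {}) + card ?R)}"
      using range unfolding m_def add_Suc by (rule image_subsetI)
    show "{w \<in> pverts G. f w = 1} = A" using f1 sub by blast
  qed
qed

text \<open>Used for \<open>G\<close> and for \<open>G\<close> with an edge deleted, this turns a
  comparison of tree-depths into one of short complement cycles.\<close>

lemma (in pair_graph) tree_depth_le_card_minus_two_iff:
  "tree_depth G + 2 \<le> card (pverts G) \<longleftrightarrow>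
    (\<exists>a b c. nonadjacent G a b \<and> nonadjacent G b c \<and> nonadjacent G c a) \<or>
    (\<exists>a b c d. distinct [a, b, c, d] \<and> nonadjacent G a b \<and> nonadjacent G b c
      \<and> nonadjacent G c d \<and> nonadjacent G d a)" (is "_ \<longleftrightarrow> ?tri \<or> ?cyc")
proof
  assume td: "tree_depth G + 2 \<le> card (pverts G)"
  obtain f where f: "feasible_labeling G f" "f ` pverts G \<subseteq> {1..tree_depth G}"
    using tree_depth_attained[OF pair_finite_verts] by blast
  note nonadj = feasible_labeling_adjacent[OF f(1)]
  have repeat: "\<exists>c d. c \<in> S \<and> d \<in> S \<and> c \<noteq> d \<and> f c = f d"
    if "S \<subseteq> pverts G" "tree_depth G < card S" for S
    using card_inj_on_le[of f S "{1..tree_depth G}"] that f(2) unfolding inj_on_def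
    by fastforce
  obtain a b where ab: "a \<in> pverts G" "b \<in> pverts G" "a \<noteq> b" "f a = f b"
    using repeat[of "pverts G"] td by auto
  \<comment> \<open>With at most n - 2 labels, pigeonhole still applies after removing
    \<open>a\<close>. The new pair may contain \<open>b\<close>; then all labels agree and
    \<open>a\<close>, \<open>c\<close>, \<open>d\<close> form a complement triangle.\<close>
  obtain c d where cd: "c \<in> pverts G" "d \<in> pverts G" "c \<noteq> a" "d \<noteq> a" "c \<noteq> d" "f c = f d"
    using repeat[of "pverts G - {a}"] td ab(1) by fastforce
  \<comment> \<open>Each of \<open>a\<close> and \<open>b\<close> has a complement neighbour among
    \<open>c\<close> and \<open>d\<close>: a common one gives a triangle, different ones a
    4-cycle.\<close>
  have pairs: "?tri \<or> ?cyc"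
    if ab: "a \<in> pverts G" "b \<in> pverts G" "a \<noteq> b" "f a = f b"
      and cd: "c \<in> pverts G" "d \<in> pverts G" "c \<noteq> d" "f c = f d" and lt: "f a < f c" for a b c d
  proof -
    have "nonadjacent G a b" "nonadjacent G c d" "nonadjacent G d c" using nonadj ab cd by auto
    moreover have "nonadjacent G c a \<or> nonadjacent G d a" "nonadjacent G b c \<or> nonadjacent G b d"
      using feasible_labeling_common_neighbour[OF f(1), of c d] ab cd lt nonadjacent_sym by metis+
    moreover have "distinct [a, b, c, d]" "distinct [a, b, d, c]" using ab cd lt by auto
    ultimately show ?thesis by blast
  qed
  show "?tri \<or> ?cyc"
  proof (cases "f a = f c")
    case True
    then show ?thesis using nonadj[of a c] nonadj[of c d] nonadj[of d a] ab cd by auto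
  next
    case False
    then consider "f a < f c" | "f c < f a" by linarith
    then show ?thesis using pairs[OF ab cd(1,2,5,6)] pairs[OF cd(1,2,5,6) ab] by cases
  qed
next
  assume "?tri \<or> ?cyc"
  then show "tree_depth G + 2 \<le> card (pverts G)"
  proof (elim disjE exE conjE)
    fix a b c assume n: "nonadjacent G a b" "nonadjacent G b c" "nonadjacent G c a"
    \<comment> \<open>One label for three vertices leaves 1 + (n - 3) labels in all.\<close>
    let ?A = "{a, b, c}"
    have sub: "?A \<subseteq> pverts G" and 3: "card ?A = 3" using n by (auto simp: nonadjacent_def)
    have "(x, y) \<notin> parcs G" if "x \<in> ?A" "y \<in> ?A" for x y
      using that n n[THEN nonadjacent_sym] by (auto simp: nonadjacent_def dest: no_loops')
    then obtain f where "feasible_labeling G f" "f ` pverts G \<subseteq> {1..Suc (card (pverts G - ?A))}"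
      using two_level_labeling[of ?A "{}"] sub by auto
    then have "tree_depth G \<le> Suc (card (pverts G - ?A))" by (rule tree_depth_le)
    then show ?thesis
      using sub 3 card_mono[OF pair_finite_verts sub] by (simp add: card_Diff_subset)
  next
    fix a b c d
    assume dist: "distinct [a, b, c, d]"
      and n: "nonadjacent G a b" "nonadjacent G b c" "nonadjacent G c d" "nonadjacent G d a"
    \<comment> \<open>Opposite edges of the complement cycle share labels, giving 2 + (n - 4). The
      other two edges keep \<open>a\<close> and \<open>b\<close> from being common neighbours of
      \<open>c\<close> and \<open>d\<close> in \<open>G\<close>.\<close>
    let ?A = "{a, b}" and ?B = "{c, d}"
    have sub: "?A \<subseteq> pverts G" "?B \<subseteq> pverts G" "?A \<union> ?B \<subseteq> pverts G"
      using n by (auto simp: nonadjacent_def)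
    have 4: "card (?A \<union> ?B) = 4" using dist by auto
    have "\<exists>f. feasible_labeling G f
      \<and> f ` pverts G \<subseteq> {1..Suc (of_bool (?B \<noteq> {}) + card (pverts G - ?A - ?B))}
      \<and> {w \<in> pverts G. f w = 1} = ?A"
      by (rule two_level_labeling)
        (use sub dist n n[THEN nonadjacent_sym] in \<open>auto simp: nonadjacent_def dest: no_loops'\<close>)
    then have "tree_depth G \<le> Suc (of_bool (?B \<noteq> {}) + card (pverts G - ?A - ?B))"
      using tree_depth_le by blast
    also have "pverts G - ?A - ?B = pverts G - (?A \<union> ?B)" by blast
    finally show ?thesis
      using 4 card_mono[OF pair_finite_verts sub(3)] card_Diff_subset[OF _ sub(3)] by simp
  qed
qed

theorem theorem2p6:
  fixes G :: "'a pair_pre_digraph" and n :: nat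
  assumes "pair_graph G"
    and "critical G"
    and "card (pverts G) = n"
    and "int (tree_depth G) \<ge> int n - 1"
  shows "one_unique G"
  unfolding one_unique_def
proof
  fix v assume v: "v \<in> pverts G"
  interpret pair_graph G by fact
  let ?goal = "\<exists>f. feasible_labeling G f \<and> f ` pverts G \<subseteq> {1..tree_depth G}
    \<and> {w \<in> pverts G. f w = 1} = {v}"
  have crit: "tree_depth H < tree_depth G" if "minor_step G H" for H
    using assms(2) that unfolding critical_def proper_minor_def by blast
  have td: "n \<le> Suc (tree_depth G)" using assms(4) by linarith
  have no_loop: "(x, x) \<notin> parcs G" for x using no_loops' by blast
  have full: ?goal if le: "n \<le> tree_depth G"
  proof -
    have "Suc (card (pverts G - {v})) = n"
      using v assms(3) card_Suc_Diff1[OF pair_finite_verts] by simp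
    then show ?thesis
      using two_level_labeling[of "{v}" "{}"] v no_loop le by fastforce
  qed
  \<comment> \<open>In the case \<open>star\<close>, complement edges off \<open>v\<close> have both
    ends adjacent to \<open>v\<close> in \<open>G\<close>, so a complement neighbour of
    \<open>v\<close> has no other complement neighbour.\<close>
  consider (pair) x y where "x \<noteq> v" "y \<noteq> v" "nonadjacent G x y" "(x, v) \<notin> parcs G \<or> (v, y) \<notin> parcs G"
    | (complete) "\<And>x y. x \<noteq> v \<Longrightarrow> y \<noteq> v \<Longrightarrow> \<not> nonadjacent G x y"
    | (star) x y where "x \<noteq> v" "y \<noteq> v" "nonadjacent G x y"
        "\<And>x y. x \<noteq> v \<Longrightarrow> y \<noteq> v \<Longrightarrow> nonadjacent G x y \<Longrightarrow> (x, v) \<in> parcs G \<and> (v, y) \<in> parcs G"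
    by blast
  then show ?goal
  proof cases
    case (pair x y)
    let ?B = "{x, y}"
    have sub: "insert v ?B \<subseteq> pverts G" using v pair by (auto simp: nonadjacent_def)
    have 3: "card (insert v ?B) = 3" using pair by (auto simp: nonadjacent_def)
    have "\<exists>f. feasible_labeling G f
      \<and> f ` pverts G \<subseteq> {1..Suc (of_bool (?B \<noteq> {}) + card (pverts G - {v} - ?B))}
      \<and> {w \<in> pverts G. f w = 1} = {v}"
      by (rule two_level_labeling)
        (use sub pair nonadjacent_sym[OF pair(3)] no_loop arcs_symmetric in \<open>auto simp: nonadjacent_def\<close>)
    moreover have "Suc (of_bool (?B \<noteq> {}) + card (pverts G - {v} - ?B)) \<le> tree_depth G"
    proof -
      have "pverts G - {v} - ?B = pverts G - insert v ?B" by blast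
      then show ?thesis
        using 3 td assms(3) card_mono[OF pair_finite_verts sub] card_Diff_subset[OF _ sub] by simp
    qed
    ultimately show ?thesis by fastforce
  next
    case complete
    let ?H = "delete_vertex G v"
    have "pverts ?H = pverts G - {v}" by (simp add: delete_vertex_def)
    moreover have "\<not> nonadjacent ?H x y" for x y
      using complete[of x y] by (auto simp: nonadjacent_def delete_vertex_def)
    ultimately have "card (pverts G - {v}) \<le> tree_depth ?H"
      using card_le_tree_depth_complete[of ?H] by simp
    then have "n \<le> tree_depth G"
      using crit[OF minor_step.delete_vertex[OF v]] assms(3) v by simp
    then show ?thesis by (rule full)
  next
    case (star x y)
    \<comment> \<open>The complement of \<open>?H\<close> is that of \<open>G\<close> with the edge
      \<open>vx\<close> added.\<close>
    let ?H = "delete_edge G v x"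
    have "(v, x) \<in> parcs G" using star arcs_symmetric by blast
    then have step: "minor_step G ?H" by (rule minor_step.delete_edge)
    interpret H: pair_graph ?H using minor_step_pair_graph[OF step] assms(1) .
    have V: "pverts ?H = pverts G" by (simp add: delete_edge_def)
    have H: "nonadjacent ?H a b \<longleftrightarrow> nonadjacent G a b \<or> (a, b) \<in> {(v, x), (x, v)}" for a b
      using v star by (auto simp: nonadjacent_def delete_edge_def)
    show ?thesis
    proof (cases "n \<le> tree_depth G")
      case False
      then have less: "tree_depth ?H + 2 \<le> card (pverts ?H)"
        using crit[OF step] assms(3) by (simp add: V)
      \<comment> \<open>In the complement of \<open>?H\<close>, only \<open>x\<close> among the
        neighbours of \<open>v\<close> can have a further neighbour. A cycle through
        \<open>v\<close> would thus need \<open>x\<close> as both neighbours of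
        \<open>v\<close>.\<close>
      have end_x: "b = x" if "nonadjacent ?H v b" "nonadjacent ?H b c" "c \<noteq> v" for b c
      proof (rule ccontr)
        assume "b \<noteq> x"
        have "b \<noteq> v" using that(1) by (auto simp: nonadjacent_def)
        then have "nonadjacent G v b" "nonadjacent G b c"
          using that \<open>b \<noteq> x\<close> star(1) by (auto simp: H)
        then show False
          using star(4)[OF that(3) \<open>b \<noteq> v\<close>] nonadjacent_sym[of b c] by (simp add: nonadjacent_def)
      qed
      have tri: "a \<noteq> v" if "nonadjacent ?H a b" "nonadjacent ?H b c" "nonadjacent ?H c a" for a b c
      proof
        assume "a = v"
        then have "b = x" "c = x" using that end_x H.nonadjacent_sym by (metis nonadjacent_def)+
        then show False using that by (simp add: nonadjacent_def)
      qed
      have cyc: "a \<noteq> v" if "distinct [a, b, c, d]" "nonadjacent ?H a b" "nonadjacent ?H b c"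
        "nonadjacent ?H c d" "nonadjacent ?H d a" for a b c d
      proof
        assume "a = v"
        then have "b = x" "d = x" using that end_x[of b c] end_x[of d c] H.nonadjacent_sym by auto
        then show False using that(1) by simp
      qed
      have off_v: "nonadjacent G a b" if "nonadjacent ?H a b" "a \<noteq> v" "b \<noteq> v" for a b
        using that by (simp add: H)
      \<comment> \<open>The short cycle forced by \<open>less\<close> avoids \<open>v\<close>, so it
        already lies in the complement of \<open>G\<close>, against \<open>td\<close>.\<close>
      from less have "tree_depth G + 2 \<le> card (pverts G)"
        unfolding H.tree_depth_le_card_minus_two_iff tree_depth_le_card_minus_two_iff
      proof (elim disjE exE conjE, goal_cases)
        case (1 a b c)
        then have "a \<noteq> v" "b \<noteq> v" "c \<noteq> v" using tri by blast+
        then show ?case using 1 off_v by blast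
      next
        case (2 a b c d)
        then have "a \<noteq> v" "b \<noteq> v" "c \<noteq> v" "d \<noteq> v"
          using cyc[of a b c d] cyc[of b c d a] cyc[of c d a b] cyc[of d a b c] by auto
        then show ?case using 2 off_v by blast
      qed
      then show ?thesis using False td assms(3) by linarith
    qed (rule full)
  qed
qed

end
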